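(* Let $p$ be a prime and let $T>0$ be real. Let $$\mathcal{F}(T)=\{\alpha/\beta\in\mathbb{Q} : \gcd(\alpha,\beta)=1,\ 1\leq \alpha,\beta\leq T\}$$ (with $\alpha,\beta$ integers). For an integer $v$, let $R_{T,p}(v)$ denote the number of fractions $\alpha/\beta\in\mathcal{F}(T)$ with $\gcd(\beta,p)=1$ and $\alpha/\beta\equiv v \pmod p$. Then $$\sum_{1\leq v\leq p-1}\left|R_{T,p}(v)-\frac{6}{\pi^2}\cdot\frac{T^2}{p}\right| = O\left(T^2p^{-1}+T\,p^{1/2+o(1)}\right),$$ where the implied constant is absolute, and $o(1)$ denotes a quantity which tends to zero as $T\to\infty$, uniformly in $p$.
   Context: The elements of $\mathcal{F}(T)$ (the Farey fractions of order $T$) are written in lowest terms $\alpha/\beta$ with positive integers $\alpha,\beta\leq T$. For $\gcd(\beta,p)=1$, the congruence $\alpha/\beta\equiv v\pmod p$ means $\alpha\equiv v\beta\pmod p$. The notation $U=O(V)$ means that $|U|\leq cV$ holds for some constant $c>0$. *)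

theory Defs
  imports "HOL-Analysis.Analysis" "HOL-Number_Theory.Number_Theory"
begin

definition farey :: "real \<Rightarrow> rat set" where
  "farey T = {of_int \<alpha> / of_int \<beta> | \<alpha> \<beta> :: int.
     coprime \<alpha> \<beta> \<and> 1 \<le> \<alpha> \<and> of_int \<alpha> \<le> T \<and> 1 \<le> \<beta> \<and> of_int \<beta> \<le> T}"

text \<open>
  \<^const>\<open>quotient_of\<close> returns the representation of a rational in lowest terms
  with positive denominator.
\<close>

definition farey_count :: "real \<Rightarrow> nat \<Rightarrow> int \<Rightarrow> nat" where
  "farey_count T p v = card {q \<in> farey T. \<exists>\<alpha> \<beta>.
     quotient_of q = (\<alpha>, \<beta>) \<and> coprime \<beta> (int p) \<and> [\<alpha> = v * \<beta>] (mod int p)}"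

end

theory Submission
  imports Defs "HOL-Computational_Algebra.Squarefree" "HOL-Real_Asymp.Real_Asymp"
begin

text \<open>
  Let $N(X, v)$ count the pairs $1 \le a, b \le X$ with $p \nmid b$ and $a \equiv v b$ modulo $p$.
  Detecting the congruence by additive characters gives, up to the pairs of multiples of $p$,
  $N(X, v) - X^2/p = p^{-1} \sum_{0 < h < p} S(h) S(-hv)$ with $S(k) = \sum_{a \le X} e(ka/p)$.
  Since $v \mapsto -hv$ permutes the nonzero residues, summing absolute values over $v$ bounds the total
  deviation by $p^{-1} (\sum_{0 < k < p} |S(k)|)^2$, which is of order $p (1 + \ln p)^2$; for $X \le p^{1/2}$
  the trivial bound $2 X^2$ is better, so in all cases the deviation is
  $O(X p^{1/2} (1 + \ln p)^2 + X^2/p)$. Moebius inversion over the common divisor $d$ of numerator and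
  denominator then applies this with $X = T/d$, and the sum over $d$ costs only another logarithm.
\<close>

section \<open>The Moebius function\<close>

definition moebius :: "nat \<Rightarrow> real" where
  "moebius n = (if squarefree n then (- 1) ^ card (prime_factors n) else 0)"

lemma abs_moebius_le: "\<bar>moebius n\<bar> \<le> 1"
  by (simp add: moebius_def)

lemma moebius_prime_mult:
  assumes q: "prime q" and "\<not> q dvd n"
  shows "moebius (q * n) = - moebius n"
proof -
  have cop: "coprime q n"
    using assms by (simp add: prime_imp_coprime)
  have "n \<noteq> 0"
    using assms(2) by (metis dvd_0_right)
  have "squarefree (q * n) \<longleftrightarrow> squarefree n"
    using cop q squarefree_mult_coprime[of q n] squarefree_multD(2)[of q n] squarefree_prime[of q]
    by blast
  moreover have "prime_factors (q * n) = insert q (prime_factors n)"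
    using q \<open>n \<noteq> 0\<close> by (simp add: prime_factors_product prime_prime_factors)
  moreover have "q \<notin> prime_factors n"
    using assms(2) by auto
  ultimately show ?thesis
    by (simp add: moebius_def)
qed

text \<open>Fix a prime q dividing n. Only squarefree divisors contribute, and d -> q * d pairs
  those prime to q with those divisible by q. By \<open>moebius_prime_mult\<close> the two members
  of a pair have opposite values, so everything cancels.\<close>

lemma sum_moebius_divisors:
  assumes "n > 0"
  shows "(\<Sum>d | d dvd n. moebius d) = (if n = 1 then 1 else 0)"
proof (cases "n = 1")
  case True
  then show ?thesis by (simp add: moebius_def)
next
  case False
  then obtain q where q: "prime q" "q dvd n"
    using prime_factor_nat by blast
  have "q > 1" using q prime_gt_1_nat by blast
  let ?D = "{d. d dvd n \<and> squarefree d}"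
  have fin: "finite {d. d dvd n}"
    using assms by simp
  have "(\<Sum>d | d dvd n. moebius d) = sum moebius ?D"
    by (rule sum.mono_neutral_right[OF fin]) (auto simp: moebius_def)
  also have "\<dots> = (\<Sum>d \<in> {d \<in> ?D. \<not> q dvd d}. moebius d) + (\<Sum>d \<in> {d \<in> ?D. q dvd d}. moebius d)"
    using fin by (subst sum.union_disjoint[symmetric]) (auto intro!: sum.cong)
  also have "(\<Sum>d \<in> {d \<in> ?D. q dvd d}. moebius d) = (\<Sum>d \<in> {d \<in> ?D. \<not> q dvd d}. moebius (q * d))"
  proof (rule sum.reindex_bij_witness[of _ "\<lambda>d. q * d" "\<lambda>d. d div q"])
    fix d assume d: "d \<in> {d \<in> ?D. q dvd d}"
    show "q * (d div q) = d" using d by simp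
    show "moebius (q * (d div q)) = moebius d" using d by simp
    have "d div q dvd d" using d by auto
    moreover have "\<not> q dvd d div q"
    proof
      assume "q dvd d div q"
      then have "q\<^sup>2 dvd d"
        using d by (metis (no_types, lifting) dvd_mult_div_cancel mem_Collect_eq mult_dvd_mono dvd_refl power2_eq_square)
      then show False
        using d q squarefreeD[of d q] by auto
    qed
    ultimately show "d div q \<in> {d \<in> ?D. \<not> q dvd d}"
      using d squarefree_mono[of "d div q" d] dvd_trans by blast
  next
    fix d assume d: "d \<in> {d \<in> ?D. \<not> q dvd d}"
    show "q * d div q = d" using \<open>q > 1\<close> by simp
    have "coprime q d"
      using d q by (simp add: prime_imp_coprime)
    then show "q * d \<in> {d \<in> ?D. q dvd d}"
      using d q by (auto intro: divides_mult squarefree_mult_coprime squarefree_prime)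
  qed
  also have "\<dots> = - (\<Sum>d \<in> {d \<in> ?D. \<not> q dvd d}. moebius d)"
    using moebius_prime_mult[OF q(1)] by (simp add: sum_negf[symmetric])
  finally show ?thesis using False by simp
qed

text \<open>
  Applied to $f(n) = 1/n^2$, this finite identity yields $\sum_{d \le Y} \mu(d)/d^2 = 6/\pi^2 + O(Y^{-1} \ln Y)$
  directly, without Dirichlet series.
\<close>

lemma sum_moebius_multiples:
  fixes f :: "nat \<Rightarrow> real"
  assumes "Y \<ge> 1"
  shows "(\<Sum>d=1..Y. moebius d * (\<Sum>m=1..Y div d. f (d * m))) = f 1"
proof -
  have "(\<Sum>d=1..Y. moebius d * (\<Sum>m=1..Y div d. f (d * m)))
      = (\<Sum>(d, m) \<in> Sigma {1..Y} (\<lambda>d. {1..Y div d}). moebius d * f (d * m))"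
    by (simp add: sum_distrib_left sum.Sigma)
  \<comment> \<open>Reindex by n = d * m: the pairs with d * m <= Y are exactly the pairs of some n
    <= Y and a divisor d of n, which brings in the divisor sum of \<open>moebius\<close>.\<close>
  also have "\<dots> = (\<Sum>(n, d) \<in> Sigma {1..Y} (\<lambda>n. {d. d dvd n}). moebius d * f n)"
  proof (rule sum.reindex_bij_witness[of _ "\<lambda>(n, d). (d, n div d)" "\<lambda>(d, m). (d * m, d)"], goal_cases)
    case (4 b)
    then obtain d m where b: "b = (d * m, d)" "d \<ge> 1" "m \<ge> 1" "d * m \<le> Y"
      by (auto simp: Suc_le_eq elim!: dvdE)
    moreover have "d \<le> Y"
      using b order_trans[of d "d * m" Y] by simp
    ultimately show ?case
      by (simp add: less_eq_div_iff_mult_less_eq mult.commute)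
  next
    case (2 a) then show ?case
      by (auto simp: less_eq_div_iff_mult_less_eq mult.commute)
  qed auto
  also have "\<dots> = (\<Sum>n=1..Y. f n * (\<Sum>d | d dvd n. moebius d))"
    by (subst sum.Sigma[symmetric]) (auto simp: sum_distrib_left mult.commute)
  also have "\<dots> = (\<Sum>n=1..Y. if n = 1 then f 1 else 0)"
    by (intro sum.cong refl) (simp add: sum_moebius_divisors)
  finally show ?thesis using assms by simp
qed

section \<open>Harmonic sums, the Basel series and the partial sums of moebius(d) / d^2\<close>

lemma sum_inverse_le_ln:
  assumes "n \<ge> 1"
  shows "(\<Sum>k=1..n. 1 / real k) \<le> 1 + ln (real n)"
  using assms
proof (induction n rule: dec_induct)
  case base
  then show ?case by simp
next
  case (step n)
  have "ln (real n / real (Suc n)) \<le> real n / real (Suc n) - 1"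
    using step by (intro ln_le_minus_one) auto
  also have "\<dots> = - 1 / real (Suc n)"
    by (simp add: field_simps)
  finally have "1 / real (Suc n) \<le> ln (real (Suc n)) - ln (real n)"
    using step by (subst (asm) ln_div) auto
  with step show ?case by simp
qed

text \<open>The partial sums f M increase, while f M + 1/M decreases because 1/(M+1)^2 <= 1/M -
  1/(M+1). The limit pi^2/6 therefore lies between the two.\<close>

lemma basel_partial_sum:
  assumes "M \<ge> 1"
  shows "\<bar>pi\<^sup>2 / 6 - (\<Sum>m=1..M. 1 / (real m)\<^sup>2)\<bar> \<le> 1 / real M"
proof -
  define f where "f M = (\<Sum>m=1..M. 1 / (real m)\<^sup>2)" for M :: nat
  have "(\<lambda>n. \<Sum>i<n. 1 / (real i + 1)\<^sup>2) \<longlonglongrightarrow> pi\<^sup>2 / 6"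
    using inverse_squares_sums by (simp add: sums_def add.commute)
  moreover have "(\<Sum>i<n. 1 / (real i + 1)\<^sup>2) = f n" for n
    unfolding f_def
    by (rule sum.reindex_bij_witness[of _ "\<lambda>k. k - 1" Suc]) (auto simp: add.commute)
  ultimately have lim: "f \<longlonglongrightarrow> pi\<^sup>2 / 6" by simp
  have mono: "f M \<le> f (Suc M)" for M
    by (simp add: f_def)
  have decr: "f (Suc M) + 1 / real (Suc M) \<le> f M + 1 / real M" if "M \<ge> 1" for M
  proof -
    have "1 / (real (Suc M))\<^sup>2 \<le> 1 / (real M * real (Suc M))"
      using that by (intro divide_left_mono) (auto simp: power2_eq_square)
    also have "\<dots> = 1 / real M - 1 / real (Suc M)"
      using that by (simp add: field_simps)
    finally show ?thesis by (simp add: f_def)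
  qed
  have "f M \<le> f n \<and> f n \<le> f M + 1 / real M" if "n \<ge> M" for n
  proof -
    have "f M \<le> f n \<and> f n + 1 / real n \<le> f M + 1 / real M"
      using that
    proof (induction n rule: dec_induct)
      case (step n)
      then show ?case
        using assms mono[of n] decr[of n] by linarith
    qed simp
    moreover have "1 / real n \<ge> 0" by simp
    ultimately show ?thesis by linarith
  qed
  then have "f M \<le> pi\<^sup>2 / 6" "pi\<^sup>2 / 6 \<le> f M + 1 / real M"
    using LIMSEQ_le_const[OF lim, of "f M"] LIMSEQ_le_const2[OF lim, of "f M + 1 / real M"] by blast+
  then show ?thesis by (simp add: f_def)
qed

text \<open>In the identity for f(n) = 1/n^2 the inner sum is a partial Basel sum up to Y div d.
  Completing it to pi^2/6 changes the term of d by at most 2 / (Y d), and the harmonic sum over d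
  produces the logarithm.\<close>

lemma moebius_over_squares_bound:
  assumes "Y \<ge> 1"
  shows "\<bar>(\<Sum>d=1..Y. moebius d / (real d)\<^sup>2) - 6 / pi\<^sup>2\<bar> \<le> 2 * (1 + ln (real Y)) / real Y"
proof -
  define P where "P M = (\<Sum>m=1..M. 1 / (real m)\<^sup>2)" for M :: nat
  let ?S = "\<Sum>d=1..Y. moebius d / (real d)\<^sup>2"
  have "(\<Sum>d=1..Y. moebius d / (real d)\<^sup>2 * P (Y div d)) = 1"
    using sum_moebius_multiples[OF assms, of "\<lambda>n. 1 / (real n)\<^sup>2"]
    by (simp add: P_def sum_distrib_left power_mult_distrib)
  then have "pi\<^sup>2 / 6 * ?S - 1 = (\<Sum>d=1..Y. moebius d / (real d)\<^sup>2 * (pi\<^sup>2 / 6 - P (Y div d)))"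
    by (simp add: sum_distrib_left right_diff_distrib sum_subtractf mult.commute)
  also have "\<bar>\<dots>\<bar> \<le> (\<Sum>d=1..Y. 2 / real Y * (1 / real d))"
  proof (rule order_trans[OF sum_abs sum_mono])
    fix d assume "d \<in> {1..Y}"
    then have d: "1 \<le> d" "d \<le> Y" by auto
    have Yd: "Y div d \<ge> 1" using d by (simp add: Suc_le_eq div_greater_zero_iff)
    \<comment> \<open>The remainder is smaller than d, hence than d * (Y div d), so Y <= 2 d (Y div
      d) and the Basel tail 1 / (Y div d) is at most 2 d / Y.\<close>
    have "Y = d * (Y div d) + Y mod d" by simp
    moreover have "Y mod d < d" "d \<le> d * (Y div d)" using d Yd by auto
    ultimately have "Y \<le> 2 * d * (Y div d)" by linarith
    then have *: "real Y \<le> 2 * real d * real (Y div d)"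
      by (metis of_nat_le_iff of_nat_mult of_nat_numeral)
    have "\<bar>moebius d / (real d)\<^sup>2 * (pi\<^sup>2 / 6 - P (Y div d))\<bar> \<le> 1 / (real d)\<^sup>2 * (1 / real (Y div d))"
      unfolding abs_mult
      using basel_partial_sum[OF Yd] abs_moebius_le[of d]
      by (intro mult_mono) (auto simp: P_def divide_right_mono)
    also have "\<dots> \<le> 2 / real Y * (1 / real d)"
    proof -
      have "real (Y div d) > 0" "real d > 0" "real Y > 0" using d Yd by linarith+
      then show ?thesis using mult_left_mono[OF *, of "real d"]
        by (simp add: divide_simps power2_eq_square mult_ac)
    qed
    finally show "\<bar>moebius d / (real d)\<^sup>2 * (pi\<^sup>2 / 6 - P (Y div d))\<bar> \<le> 2 / real Y * (1 / real d)" .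
  qed
  also have "\<dots> \<le> 2 / real Y * (1 + ln (real Y))"
    unfolding sum_distrib_left[symmetric]
    using sum_inverse_le_ln[OF assms] by (intro mult_left_mono) auto
  finally have *: "\<bar>pi\<^sup>2 / 6 * ?S - 1\<bar> \<le> 2 * (1 + ln (real Y)) / real Y" by simp
  \<comment> \<open>As pi^2/6 exceeds 1, dividing by it does not worsen the bound.\<close>
  have "pi\<^sup>2 > 6" 
    using power_strict_mono[OF pi_gt3, of 2] by simp
  then have "\<bar>?S - 6 / pi\<^sup>2\<bar> \<le> pi\<^sup>2 / 6 * \<bar>?S - 6 / pi\<^sup>2\<bar>"
    by (intro mult_le_cancel_right1[THEN iffD2]) auto
  also have "\<dots> = \<bar>pi\<^sup>2 / 6 * (?S - 6 / pi\<^sup>2)\<bar>"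
    by (simp add: abs_mult)
  also have "pi\<^sup>2 / 6 * (?S - 6 / pi\<^sup>2) = pi\<^sup>2 / 6 * ?S - 1"
    by (simp add: right_diff_distrib)
  finally have "\<bar>?S - 6 / pi\<^sup>2\<bar> \<le> \<bar>pi\<^sup>2 / 6 * ?S - 1\<bar>" .
  with * show ?thesis by linarith
qed

section \<open>Additive characters and the congruence in a box\<close>

definition add_char :: "nat \<Rightarrow> int \<Rightarrow> complex" where
  "add_char p k = cis (2 * pi * of_int k / real p)"

lemma add_char_add: "add_char p (k + l) = add_char p k * add_char p l"
  by (simp add: add_char_def cis_mult add_divide_distrib ring_distribs)

lemma add_char_mult_nat: "add_char p (int n * k) = add_char p k ^ n"
  unfolding add_char_def Complex.DeMoivre by (rule arg_cong[where f = cis]) simp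

lemma norm_add_char [simp]: "norm (add_char p k) = 1"
  by (simp add: add_char_def)

lemma add_char_eq_1_iff:
  assumes "p > 0"
  shows "add_char p k = 1 \<longleftrightarrow> int p dvd k"
proof
  assume "add_char p k = 1"
  then have "cos (2 * pi * of_int k / real p) = 1"
    by (metis add_char_def cis.sel(1) one_complex.sel(1))
  then obtain n :: int where "2 * pi * of_int k / real p = of_int n * 2 * pi"
    by (auto simp: cos_one_2pi_int)
  then have "real_of_int k = of_int (n * int p)"
    using assms by (simp add: field_simps)
  then show "int p dvd k"
    by (metis dvd_triv_right of_int_eq_iff)
next
  assume "int p dvd k"
  then obtain n where "k = int p * n" by blast
  then show "add_char p k = 1"
    using assms cis_multiple_2pi[of "of_int n"] by (simp add: add_char_def mult.assoc)
qed

lemma add_char_cong: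
  assumes "p > 0" "[k = l] (mod int p)"
  shows "add_char p k = add_char p l"
proof -
  have "add_char p (k - l) = 1"
    using assms by (simp add: add_char_eq_1_iff cong_iff_dvd_diff)
  then show ?thesis
    using add_char_add[of p "k - l" l] by simp
qed

text \<open>Orthogonality of characters: this is a geometric series whose ratio
  \<open>add_char p k\<close> is a p-th root of unity, equal to 1 exactly when p divides k.\<close>

lemma sum_add_char:
  assumes "p > 0"
  shows "(\<Sum>h<p. add_char p (int h * k)) = (if int p dvd k then of_nat p else 0)"
proof -
  have "add_char p k ^ p = 1"
    using assms add_char_eq_1_iff[of p "int p * k"] by (simp add: add_char_mult_nat)
  then show ?thesis
    using assms by (simp add: add_char_mult_nat sum_gp_strict add_char_eq_1_iff)
qed

section \<open>Character sums over an interval\<close>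

definition interval_sum :: "nat \<Rightarrow> nat \<Rightarrow> int \<Rightarrow> complex" where
  "interval_sum p X k = (\<Sum>a=1..X. add_char p (k * int a))"

lemma interval_sum_cong:
  assumes "p > 0" "[k = l] (mod int p)"
  shows "interval_sum p X k = interval_sum p X l"
  unfolding interval_sum_def
  using assms by (intro sum.cong refl add_char_cong cong_mult) auto

text \<open>The Taylor bound sin x >= x - x^3/6 together with x^2 <= 4 leaves x - 2x/3. The range up
  to 2 covers all angles up to pi/2, which is what the next lemma needs.\<close>

lemma third_le_sin:
  fixes x :: real
  assumes "0 \<le> x" "x \<le> 2"
  shows "x / 3 \<le> sin x"
proof -
  have "x * x \<le> 2 * 2" using assms by (intro mult_mono) auto
  then have "x * (x * x) \<le> x * 4" using assms by (intro mult_left_mono) auto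
  moreover have "\<bar>sin x - x\<bar> \<le> x * (x * x) / 6"
    using Maclaurin_sin_bound[of x 3] assms
    by (simp add: sin_coeff_def eval_nat_numeral fact_numeral divide_simps)
  ultimately show ?thesis by linarith
qed

text \<open>The distance equals 2 |sin(pi k/p)|, and the sine is unchanged under k -> p - k, so k
  may be replaced by the smaller m <= p/2. The loss of 1/3 in \<open>third_le_sin\<close> is made up
  by pi > 3.\<close>

lemma norm_add_char_minus_1:
  assumes "0 < k" "k < int p"
  shows "2 * of_int (min k (int p - k)) / real p \<le> norm (add_char p k - 1)"
proof -
  define m where "m = min k (int p - k)"
  have m: "0 < m" "2 * m \<le> int p"
    using assms by (auto simp: m_def min_def)
  then have m': "0 < real_of_int m" "2 * real_of_int m \<le> real p"
    by linarith+
  have "real_of_int m / real p \<le> 1 / 2"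
    using m' by (simp add: field_simps)
  then have le2: "pi * (of_int m / real p) \<le> 4 * (1 / 2)"
    using pi_less_4 m' by (intro mult_mono) auto
  have "sin (pi * of_int k / real p) = sin (pi * of_int m / real p)"
  proof (cases "m = k")
    case False
    then have "real_of_int m = real p - of_int k" by (auto simp: m_def min_def split: if_splits)
    then have "pi * of_int m / real p = pi - pi * of_int k / real p"
      using assms by (simp add: diff_divide_distrib right_diff_distrib)
    then show ?thesis by (simp add: sin_pi_minus)
  qed simp
  moreover have "of_int m / real p \<le> pi * (of_int m / real p) / 3"
    using pi_gt3 m' mult_right_mono[of 3 pi "of_int m / real p"] by simp
  moreover have "pi * (of_int m / real p) / 3 \<le> sin (pi * (of_int m / real p))"
    using le2 m' by (intro third_le_sin) auto
  ultimately have "of_int m / real p \<le> \<bar>sin (pi * of_int k / real p)\<bar>"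
    by simp
  also have "2 * \<dots> = norm (add_char p k - 1)"
    using dist_exp_i_1[of "2 * pi * of_int k / real p"]
    by (simp add: add_char_def cis_conv_exp)
  finally show ?thesis by (simp add: m_def)
qed

text \<open>Multiplying the geometric series by 1 - z leaves a quantity of norm at most 2, so the
  sum is at most p / min(k, p - k). The minimum is traded for two reciprocals, whose sums over k
  agree by the reflection k -> p - k.\<close>

lemma norm_interval_sum_le:
  assumes "0 < k" "k < int p"
  shows "norm (interval_sum p X k) \<le> real p / of_int k + real p / of_int (int p - k)"
proof -
  define z where "z = add_char p k"
  define m where "m = min k (int p - k)"
  have "m > 0" "p > 0"
    using assms by (auto simp: m_def)
  have "interval_sum p X k = (\<Sum>a=1..X. z ^ a)"
    by (simp add: interval_sum_def z_def add_char_mult_nat mult.commute[of k])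
  then have "norm (1 - z) * norm (interval_sum p X k) = norm (z * (1 - z ^ X))"
  proof (cases "X = 0")
    case False
    then show ?thesis
      using sum_gp_multiplied[of 1 X z] \<open>interval_sum p X k = _\<close>
      by (simp add: norm_mult[symmetric] right_diff_distrib)
  qed simp
  also have "\<dots> \<le> 2"
    using norm_triangle_ineq4[of 1 "z ^ X"] by (simp add: norm_mult norm_power z_def)
  finally have "norm (1 - z) * norm (interval_sum p X k) \<le> 2" .
  moreover have "2 * of_int m / real p \<le> norm (1 - z)"
    using norm_add_char_minus_1[OF assms] by (simp add: z_def m_def norm_minus_commute)
  ultimately have "2 * of_int m / real p * norm (interval_sum p X k) \<le> 2"
    by (meson mult_right_mono norm_ge_zero order_trans)
  then have "norm (interval_sum p X k) \<le> real p / of_int m"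
    using \<open>m > 0\<close> \<open>p > 0\<close> by (simp add: field_simps)
  also have "\<dots> \<le> real p / of_int k + real p / of_int (int p - k)"
    using assms by (auto simp: m_def min_def)
  finally show ?thesis .
qed

lemma sum_norm_interval_sum_le:
  assumes "p \<ge> 2"
  shows "(\<Sum>k=1..int p - 1. norm (interval_sum p X k)) \<le> 2 * real p * (1 + ln (real p))"
proof -
  have "(\<Sum>k=1..p - 1. 1 / real k) \<le> 1 + ln (real (p - 1))"
    using assms by (intro sum_inverse_le_ln) auto
  also have "ln (real (p - 1)) \<le> ln (real p)"
    using assms by (subst ln_le_cancel_iff) auto
  finally have "real p * (\<Sum>k=1..p - 1. 1 / real k) \<le> real p * (1 + ln (real p))"
    by (intro mult_left_mono) auto
  moreover have "real p * (\<Sum>k=1..p - 1. 1 / real k) = (\<Sum>k=1..int p - 1. real p / of_int k)"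
    unfolding sum_distrib_left
    by (rule sum.reindex_bij_witness[of _ nat int]) auto
  moreover have "(\<Sum>k=1..int p - 1. real p / of_int (int p - k)) = (\<Sum>k=1..int p - 1. real p / of_int k)"
    by (rule sum.reindex_bij_witness[of _ "\<lambda>k. int p - k" "\<lambda>k. int p - k"]) auto
  moreover have "(\<Sum>k=1..int p - 1. norm (interval_sum p X k))
      \<le> (\<Sum>k=1..int p - 1. real p / of_int k + real p / of_int (int p - k))"
    by (intro sum_mono norm_interval_sum_le) auto
  ultimately show ?thesis
    by (simp add: sum.distrib)
qed

lemma bij_betw_mult_mod_prime:
  assumes "prime p" "\<not> int p dvd c"
  shows "bij_betw (\<lambda>v. (c * v) mod int p) {1..int p - 1} {1..int p - 1}"
proof -
  let ?f = "\<lambda>v. (c * v) mod int p"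
  have p: "prime (int p)" "int p > 1"
    using assms prime_gt_1_nat[of p] by auto
  have cop: "coprime c (int p)"
    using p assms(2) by (metis coprime_commute prime_imp_coprime)
  have "?f ` {1..int p - 1} \<subseteq> {1..int p - 1}"
  proof
    fix w assume "w \<in> ?f ` {1..int p - 1}"
    then obtain v where v: "w = ?f v" "0 < v" "v < int p"
      by (auto simp del: mod_mult_self1 mod_mult_self2)
    then have "\<not> int p dvd v" using zdvd_not_zless by blast
    then have "\<not> int p dvd c * v" using assms p by (simp add: prime_dvd_mult_iff)
    then have "w \<noteq> 0" unfolding v(1) dvd_eq_mod_eq_0 .
    then show "w \<in> {1..int p - 1}"
      using p(2) pos_mod_sign[of "int p" "c * v"] pos_mod_bound[of "int p" "c * v"]
      unfolding v(1) atLeastAtMost_iff by linarith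
  qed
  moreover have "inj_on ?f {1..int p - 1}"
  proof (rule inj_onI)
    fix v w assume vw: "v \<in> {1..int p - 1}" "w \<in> {1..int p - 1}" "?f v = ?f w"
    then have "[v = w] (mod int p)"
      using cong_mult_lcancel[OF cop, of v w] unfolding cong_def by blast
    then show "v = w"
      using vw(1,2) by (intro cong_less_imp_eq_int[of v "int p" w]) auto
  qed
  ultimately show ?thesis
    by (intro bij_betw_imageI endo_inj_surj) auto
qed

section \<open>Fourier analysis of the congruence in the full box\<close>

definition congruence_pairs :: "nat \<Rightarrow> nat \<Rightarrow> int \<Rightarrow> (nat \<times> nat) set" where
  "congruence_pairs p X v = {(a, b) \<in> {1..X} \<times> {1..X}. [int a = v * int b] (mod int p)}"

text \<open>Orthogonality applied to a - v b detects the congruence. Since b runs over the whole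
  interval, with no condition modulo p, the double sum over (a, b) factors into two interval sums
  for every frequency h.\<close>

lemma congruence_pairs_fourier:
  assumes "p > 0"
  shows "of_nat (p * card (congruence_pairs p X v))
       = (\<Sum>h<p. interval_sum p X (int h) * interval_sum p X (- (int h * v)))"
proof -
  have "(\<Sum>h<p. interval_sum p X (int h) * interval_sum p X (- (int h * v)))
      = (\<Sum>h<p. \<Sum>a=1..X. \<Sum>b=1..X. add_char p (int h * (int a - v * int b)))"
    by (simp add: interval_sum_def sum_product add_char_add[symmetric] algebra_simps)
  also have "\<dots> = (\<Sum>a=1..X. \<Sum>h<p. \<Sum>b=1..X. add_char p (int h * (int a - v * int b)))"
    by (rule sum.swap)
  also have "\<dots> = (\<Sum>a=1..X. \<Sum>b=1..X. \<Sum>h<p. add_char p (int h * (int a - v * int b)))"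
    by (intro sum.cong refl sum.swap)
  also have "\<dots> = (\<Sum>a=1..X. \<Sum>b=1..X. if int p dvd int a - v * int b then of_nat p else 0)"
    by (simp add: sum_add_char assms)
  also have "\<dots> = (\<Sum>x \<in> {1..X} \<times> {1..X}. if x \<in> congruence_pairs p X v then of_nat p else 0)"
    by (simp add: sum.cartesian_product congruence_pairs_def cong_iff_dvd_diff case_prod_unfold mem_Times_iff)
  also have "\<dots> = (\<Sum>x \<in> congruence_pairs p X v. of_nat p)"
  proof -
    have "({1..X} \<times> {1..X}) \<inter> congruence_pairs p X v = congruence_pairs p X v"
      by (auto simp: congruence_pairs_def)
    then show ?thesis
      using sum.inter_restrict[of "{1..X} \<times> {1..X}" "\<lambda>_. of_nat p :: complex" "congruence_pairs p X v"] by simp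
  qed
  finally show ?thesis by simp
qed

text \<open>After summation over v the second factor no longer depends on h, because multiplication
  by -h permutes the nonzero residues. The total is 1/p times the square of the bound in
  \<open>sum_norm_interval_sum_le\<close>, uniformly in X.\<close>

lemma congruence_pairs_deviation:
  assumes "prime p"
  shows "(\<Sum>v=1..int p - 1. \<bar>real (card (congruence_pairs p X v)) - (real X)\<^sup>2 / real p\<bar>)
       \<le> 4 * real p * (1 + ln (real p))\<^sup>2"
proof -
  let ?S = "\<lambda>k. norm (interval_sum p X k)"
  let ?V = "{1..int p - 1}"
  have p: "p \<ge> 2" "p > 0"
    using assms prime_ge_2_nat prime_gt_0_nat by blast+
  have dev: "real p * \<bar>real (card (congruence_pairs p X v)) - (real X)\<^sup>2 / real p\<bar>
      \<le> (\<Sum>h=1..<p. ?S (int h) * ?S (- int h * v))" for v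
  proof -
    \<comment> \<open>The frequency h = 0 contributes X^2 and yields the expected value; the other
      frequencies form the error.\<close>
    have "{..<p} = insert 0 {1..<p}" using p by auto
    then have "of_nat (p * card (congruence_pairs p X v)) = interval_sum p X 0 * interval_sum p X 0 +
        (\<Sum>h=1..<p. interval_sum p X (int h) * interval_sum p X (- int h * v))"
      unfolding congruence_pairs_fourier[OF p(2)] by simp
    moreover have "interval_sum p X 0 = of_nat X"
      by (simp add: interval_sum_def add_char_def)
    ultimately have "of_nat (p * card (congruence_pairs p X v)) = (of_nat X)\<^sup>2 +
        (\<Sum>h=1..<p. interval_sum p X (int h) * interval_sum p X (- int h * v))"
      by (simp only: power2_eq_square)
    then have "of_real (real p * real (card (congruence_pairs p X v)) - (real X)\<^sup>2) =
        (\<Sum>h=1..<p. interval_sum p X (int h) * interval_sum p X (- int h * v))"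
      by simp
    then have "\<bar>real p * real (card (congruence_pairs p X v)) - (real X)\<^sup>2\<bar> =
        norm (\<Sum>h=1..<p. interval_sum p X (int h) * interval_sum p X (- int h * v))"
      by (metis norm_of_real)
    also have "\<dots> \<le> (\<Sum>h=1..<p. ?S (int h) * ?S (- int h * v))"
      by (rule order_trans[OF norm_sum]) (simp add: norm_mult)
    finally have "\<bar>real p * real (card (congruence_pairs p X v)) - (real X)\<^sup>2\<bar> \<le> (\<Sum>h=1..<p. ?S (int h) * ?S (- int h * v))" .
    moreover have "real p * real (card (congruence_pairs p X v)) - (real X)\<^sup>2 = real p * (real (card (congruence_pairs p X v)) - (real X)\<^sup>2 / real p)"
      using p by (simp add: right_diff_distrib)
    ultimately show ?thesis
      by (simp only: abs_mult abs_of_nat)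
  qed
  have perm: "(\<Sum>v\<in>?V. ?S (- int h * v)) = (\<Sum>k\<in>?V. ?S k)" if "h \<in> {1..<p}" for h
  proof -
    have "\<not> int p dvd - int h"
      using that by (auto dest: dvd_imp_le)
    then have "(\<Sum>k\<in>?V. ?S k) = (\<Sum>v\<in>?V. ?S ((- int h * v) mod int p))"
      using sum.reindex_bij_betw[OF bij_betw_mult_mod_prime[OF assms], of "- int h" ?S] by simp
    also have "\<dots> = (\<Sum>v\<in>?V. ?S (- int h * v))"
      using p by (intro sum.cong refl arg_cong[where f = norm] interval_sum_cong) (auto simp: cong_def)
    finally show ?thesis by simp
  qed
  have "real p * (\<Sum>v\<in>?V. \<bar>real (card (congruence_pairs p X v)) - (real X)\<^sup>2 / real p\<bar>)
      \<le> (\<Sum>v\<in>?V. \<Sum>h=1..<p. ?S (int h) * ?S (- int h * v))"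
    unfolding sum_distrib_left by (intro sum_mono dev)
  also have "\<dots> = (\<Sum>h=1..<p. \<Sum>v\<in>?V. ?S (int h) * ?S (- int h * v))"
    by (rule sum.swap)
  also have "\<dots> = (\<Sum>h=1..<p. ?S (int h) * (\<Sum>k\<in>?V. ?S k))"
    using perm by (intro sum.cong refl) (simp add: sum_distrib_left[symmetric])
  also have "\<dots> = (\<Sum>h=1..<p. ?S (int h)) * (\<Sum>k\<in>?V. ?S k)"
    by (simp add: sum_distrib_right)
  also have "(\<Sum>h=1..<p. ?S (int h)) = (\<Sum>k\<in>?V. ?S k)"
    by (rule sum.reindex_bij_witness[of _ nat int]) auto
  also have "(\<Sum>k\<in>?V. ?S k) * (\<Sum>k\<in>?V. ?S k)
      \<le> (2 * real p * (1 + ln (real p))) * (2 * real p * (1 + ln (real p)))"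
    using p by (intro mult_mono sum_norm_interval_sum_le sum_nonneg mult_nonneg_nonneg) auto
  also have "\<dots> = real p * (4 * real p * (1 + ln (real p))\<^sup>2)"
    by (simp add: power2_eq_square)
  finally show ?thesis using p by simp
qed

section \<open>Removing the denominators divisible by p\<close>

definition unit_pairs :: "nat \<Rightarrow> nat \<Rightarrow> int \<Rightarrow> (nat \<times> nat) set" where
  "unit_pairs p X v = {(a, b) \<in> {1..X} \<times> {1..X}. \<not> p dvd b \<and> [int a = v * int b] (mod int p)}"

lemma finite_unit_pairs [simp]: "finite (unit_pairs p X v)"
  by (auto simp: unit_pairs_def intro: finite_subset[of _ "{1..X} \<times> {1..X}"])

text \<open>As b is invertible modulo p, a pair (a, b) determines v modulo p. The sets for different
  v are thus disjoint subsets of one box with X^2 points.\<close>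

lemma sum_card_unit_pairs_le:
  assumes "prime p"
  shows "(\<Sum>v=1..int p - 1. real (card (unit_pairs p X v))) \<le> (real X)\<^sup>2"
proof -
  have "(\<Sum>v=1..int p - 1. card (unit_pairs p X v)) = card (\<Union>v\<in>{1..int p - 1}. unit_pairs p X v)"
  proof (rule card_UN_disjoint[symmetric])
    show "\<forall>v\<in>{1..int p - 1}. finite (unit_pairs p X v)"
      by simp
    show "\<forall>v\<in>{1..int p - 1}. \<forall>w\<in>{1..int p - 1}. v \<noteq> w \<longrightarrow> unit_pairs p X v \<inter> unit_pairs p X w = {}"
    proof (intro ballI impI equals0I)
      fix v w x assume *: "v \<in> {1..int p - 1}" "w \<in> {1..int p - 1}" "v \<noteq> w" "x \<in> unit_pairs p X v \<inter> unit_pairs p X w"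
      then obtain a b where ab: "\<not> p dvd b" "[int a = v * int b] (mod int p)" "[int a = w * int b] (mod int p)"
        by (auto simp: unit_pairs_def)
      have "coprime (int b) (int p)"
        using assms ab(1) by (metis coprime_commute coprime_int_iff prime_imp_coprime)
      moreover have "[v * int b = w * int b] (mod int p)"
        using ab(2,3) cong_sym cong_trans by blast
      ultimately have "[v = w] (mod int p)"
        using cong_mult_rcancel by blast
      then show False
        using *(1-3) cong_less_imp_eq_int[of v "int p" w] by simp
    qed
  qed simp
  also have "\<dots> \<le> card ({1..X} \<times> {1..X})"
    by (rule card_mono) (auto simp: unit_pairs_def)
  also have "\<dots> = X\<^sup>2" by (simp add: power2_eq_square)
  finally show ?thesis
    by (metis of_nat_le_iff of_nat_power of_nat_sum)
qed

text \<open>When p divides b, the congruence says precisely that p divides a. The excluded pairs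
  therefore form the square of the set of multiples of p up to X.\<close>

lemma card_congruence_pairs:
  assumes "prime p" "v \<in> {1..int p - 1}"
  shows "card (congruence_pairs p X v) = card (unit_pairs p X v) + (X div p)\<^sup>2"
proof -
  have p: "p > 0" using assms prime_gt_0_nat by blast
  let ?M = "{a \<in> {1..X}. p dvd a}"
  have "[int a = v * int b] (mod int p) \<longleftrightarrow> p dvd a" if "p dvd b" for a b
  proof -
    have "int p dvd v * int b" using that by simp
    then show ?thesis by (simp add: cong_iff_dvd_diff dvd_diff_left_iff)
  qed
  then have "congruence_pairs p X v = unit_pairs p X v \<union> ?M \<times> ?M"
    by (auto simp: congruence_pairs_def unit_pairs_def)
  moreover have "unit_pairs p X v \<inter> ?M \<times> ?M = {}"
    by (auto simp: unit_pairs_def)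
  ultimately have "card (congruence_pairs p X v) = card (unit_pairs p X v) + (card ?M)\<^sup>2"
    by (simp add: card_Un_disjoint power2_eq_square)
  moreover have "?M = (\<lambda>k. p * k) ` {1..X div p}"
    using p by (auto simp: less_eq_div_iff_mult_less_eq mult.commute Suc_le_eq elim!: dvdE)
  then have "card ?M = X div p"
    using p by (simp add: card_image inj_on_def)
  ultimately show ?thesis by simp
qed

lemma unit_pairs_deviation:
  assumes "prime p"
  shows "(\<Sum>v=1..int p - 1. \<bar>real (card (unit_pairs p X v)) - (real X)\<^sup>2 / real p\<bar>)
       \<le> 4 * real X * sqrt (real p) * (1 + ln (real p))\<^sup>2 + (real X)\<^sup>2 / real p"
proof -
  let ?V = "{1..int p - 1}"
  have "p \<ge> 2" using assms prime_ge_2_nat by blast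
  then have p: "p \<ge> 2" "p > 0" "card ?V < p" by auto
  \<comment> \<open>Allows the logarithmic factor to be inserted for small X, where the trivial
    bound has none.\<close>
  have ge1: "1 \<le> (1 + ln (real p))\<^sup>2"
    using p by (intro one_le_power) auto
  \<comment> \<open>Counting pairs gives a deviation of at most $2X^2$, Fourier analysis gives $4p(1+\ln p)^2 + X^2/p$;
    the two balance at $X = p^{1/2}$.\<close>
  show ?thesis
  proof (cases "real X \<le> sqrt (real p)")
    case True
    have "(\<Sum>v\<in>?V. \<bar>real (card (unit_pairs p X v)) - (real X)\<^sup>2 / real p\<bar>)
        \<le> (\<Sum>v\<in>?V. real (card (unit_pairs p X v)) + (real X)\<^sup>2 / real p)"
      by (intro sum_mono) (simp add: abs_le_iff)
    also have "\<dots> \<le> (real X)\<^sup>2 + real p * ((real X)\<^sup>2 / real p)"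
      unfolding sum.distrib sum_constant
      using p sum_card_unit_pairs_le[OF assms] by (intro add_mono mult_right_mono) auto
    also have "\<dots> = 2 * (real X * real X)"
      using p by (simp add: power2_eq_square)
    also have "\<dots> \<le> 4 * (real X * sqrt (real p))"
      using mult_left_mono[OF True of_nat_0_le_iff[of X]]
        mult_nonneg_nonneg[OF of_nat_0_le_iff[of X] real_sqrt_ge_zero[OF of_nat_0_le_iff[of p]]] by linarith
    also have "\<dots> \<le> 4 * (real X * sqrt (real p)) * (1 + ln (real p))\<^sup>2"
      using mult_left_mono[OF ge1, of "4 * (real X * sqrt (real p))"] by simp
    also have "\<dots> \<le> 4 * real X * sqrt (real p) * (1 + ln (real p))\<^sup>2 + (real X)\<^sup>2 / real p"
      by simp
    finally show ?thesis .
  next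
    case False
    have "real (X div p) \<le> real X / real p"
      by (rule of_nat_div_le_of_nat)
    then have mult: "(real (X div p))\<^sup>2 \<le> (real X / real p)\<^sup>2"
      by (intro power_mono) auto
    have "(\<Sum>v\<in>?V. \<bar>real (card (unit_pairs p X v)) - (real X)\<^sup>2 / real p\<bar>)
        \<le> (\<Sum>v\<in>?V. \<bar>real (card (congruence_pairs p X v)) - (real X)\<^sup>2 / real p\<bar> + (real X / real p)\<^sup>2)"
    proof (intro sum_mono)
      fix v assume "v \<in> ?V"
      then have "real (card (congruence_pairs p X v)) = real (card (unit_pairs p X v)) + (real (X div p))\<^sup>2"
        by (simp add: card_congruence_pairs[OF assms])
      then show "\<bar>real (card (unit_pairs p X v)) - (real X)\<^sup>2 / real p\<bar>
          \<le> \<bar>real (card (congruence_pairs p X v)) - (real X)\<^sup>2 / real p\<bar> + (real X / real p)\<^sup>2"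
        using mult zero_le_power2[of "real (X div p)"] by linarith
    qed
    also have "\<dots> \<le> 4 * real p * (1 + ln (real p))\<^sup>2 + real p * (real X / real p)\<^sup>2"
      unfolding sum.distrib sum_constant
      using p congruence_pairs_deviation[OF assms] by (intro add_mono mult_right_mono) auto
    also have "real p * (real X / real p)\<^sup>2 = (real X)\<^sup>2 / real p"
      using p by (simp add: power2_eq_square)
    \<comment> \<open>Here sqrt p < X, so p = sqrt p * sqrt p is at most X * sqrt p.\<close>
    also have "4 * real p * (1 + ln (real p))\<^sup>2 \<le> 4 * (real X * sqrt (real p)) * (1 + ln (real p))\<^sup>2"
      using mult_right_mono[of "sqrt (real p)" "real X" "sqrt (real p)"] False
      by (intro mult_right_mono) auto
    finally show ?thesis by (simp add: mult.assoc)
  qed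
qed

section \<open>Farey fractions\<close>

lemma quotient_of_of_nat_divide:
  assumes "coprime a b" "b > 0"
  shows "quotient_of (of_nat a / of_nat b) = (int a, int b)"
proof -
  have "quotient_of (Fract (int a) (int b)) = (int a, int b)"
    unfolding quotient_of_Fract using assms by (intro normalize_stable) auto
  then show ?thesis by (simp add: Fract_of_int_quotient)
qed

text \<open>For negative T the conversion \<open>nat\<close> yields 0, and positivity of n makes
  both sides false.\<close>

lemma le_nat_floor_iff:
  assumes "n > 0"
  shows "n \<le> nat \<lfloor>T\<rfloor> \<longleftrightarrow> real n \<le> (T :: real)"
proof -
  have "n \<le> nat \<lfloor>T\<rfloor> \<longleftrightarrow> int n \<le> \<lfloor>T\<rfloor>"
    using assms by linarith
  then show ?thesis by (simp add: le_floor_iff)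
qed

text \<open>Reduced representations are unique: \<open>quotient_of\<close> recovers (a, b) from a /
  b for coprime a, b, so counting fractions is counting coprime pairs.\<close>

lemma farey_count_eq:
  assumes "prime p"
  shows "farey_count T p v = card {(a, b) \<in> unit_pairs p (nat \<lfloor>T\<rfloor>) v. coprime a b}"
proof -
  let ?U = "{(a, b) \<in> unit_pairs p (nat \<lfloor>T\<rfloor>) v. coprime a b}"
  let ?q = "\<lambda>(a, b). of_nat a / of_nat b :: rat"
  have cop: "coprime (int b) (int p) \<longleftrightarrow> \<not> p dvd b" for b
    using assms by (metis coprime_commute coprime_int_iff prime_imp_coprime coprime_absorb_left not_prime_unit)
  have quot: "quotient_of (?q (a, b)) = (int a, int b)" if "(a, b) \<in> ?U" for a b
    using that by (auto simp: unit_pairs_def intro!: quotient_of_of_nat_divide)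
  have "inj_on ?q ?U"
  proof (rule inj_onI)
    fix x y assume "x \<in> ?U" "y \<in> ?U" "?q x = ?q y"
    then show "x = y"
      using quot[of "fst x" "snd x"] quot[of "fst y" "snd y"]
      by (cases x; cases y) (simp del: quotient_of_div)
  qed
  moreover have "?q ` ?U = {q \<in> farey T. \<exists>\<alpha> \<beta>.
     quotient_of q = (\<alpha>, \<beta>) \<and> coprime \<beta> (int p) \<and> [\<alpha> = v * \<beta>] (mod int p)}" (is "_ = ?F")
  proof (intro equalityI subsetI)
    fix q assume "q \<in> ?q ` ?U"
    then obtain a b where ab: "(a, b) \<in> ?U" "q = ?q (a, b)" by auto
    then have "q = of_int (int a) / of_int (int b)" "coprime (int a) (int b)"
        "1 \<le> int a" "of_int (int a) \<le> T" "1 \<le> int b" "of_int (int b) \<le> T"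
      by (auto simp: unit_pairs_def le_nat_floor_iff)
    then have "q \<in> farey T"
      unfolding farey_def by blast
    then show "q \<in> ?F"
      using ab quot[OF ab(1)] cop by (auto simp: unit_pairs_def)
  next
    fix q assume "q \<in> ?F"
    then obtain \<alpha> \<beta> where q: "q = of_int \<alpha> / of_int \<beta>" "coprime \<alpha> \<beta>" "1 \<le> \<alpha>" "of_int \<alpha> \<le> T" "1 \<le> \<beta>" "of_int \<beta> \<le> T"
      "\<exists>\<alpha> \<beta>. quotient_of q = (\<alpha>, \<beta>) \<and> coprime \<beta> (int p) \<and> [\<alpha> = v * \<beta>] (mod int p)"
      by (auto simp: farey_def)
    define a b where "a = nat \<alpha>" "b = nat \<beta>"
    have ab: "\<alpha> = int a" "\<beta> = int b" "a \<ge> 1" "b \<ge> 1"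
      using q by (auto simp: a_b_def)
    then have "quotient_of q = (int a, int b)"
      using q by (auto intro!: quotient_of_of_nat_divide)
    then have "(a, b) \<in> ?U"
      using q ab cop by (auto simp: unit_pairs_def le_nat_floor_iff)
    then show "q \<in> ?q ` ?U"
      using q(1) ab by force
  qed
  ultimately show ?thesis
    by (simp add: farey_count_def card_image[symmetric])
qed

text \<open>If p divides d, then d dvd b contradicts the condition on b. Otherwise d is invertible
  modulo p and cancels from the congruence, so division by d maps the pairs bijectively onto those
  in the box of side M div d.\<close>

lemma card_unit_pairs_multiples:
  assumes "d > 0" "prime p"
  shows "card {(a, b) \<in> unit_pairs p M v. d dvd a \<and> d dvd b}
       = (if p dvd d then 0 else card (unit_pairs p (M div d) v))"
proof (cases "p dvd d")
  case True
  then have "{(a, b) \<in> unit_pairs p M v. d dvd a \<and> d dvd b} = {}"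
    by (auto simp: unit_pairs_def dest: dvd_trans)
  with True show ?thesis by (simp only: card.empty if_True)
next
  case False
  have "coprime (int d) (int p)"
    using assms False by (metis coprime_commute coprime_int_iff prime_imp_coprime)
  then have cong: "[int (a * d) = v * int (b * d)] (mod int p) \<longleftrightarrow> [int a = v * int b] (mod int p)" for a b
    using cong_mult_rcancel[of "int d" "int p" "int a" "v * int b"] by (simp add: mult_ac)
  have dvd: "p dvd b * d \<longleftrightarrow> p dvd b" for b
    using assms False by (simp add: prime_dvd_mult_iff)
  have "{(a, b) \<in> unit_pairs p M v. d dvd a \<and> d dvd b} = (\<lambda>(a, b). (d * a, d * b)) ` unit_pairs p (M div d) v"
  proof (intro equalityI subsetI)
    fix x assume "x \<in> {(a, b) \<in> unit_pairs p M v. d dvd a \<and> d dvd b}"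
    then obtain a b where "x = (d * a, d * b)" "(d * a, d * b) \<in> unit_pairs p M v"
      by (auto elim!: dvdE)
    moreover from this have "(a, b) \<in> unit_pairs p (M div d) v"
      using assms(1) unfolding unit_pairs_def
      by (auto simp: cong dvd less_eq_div_iff_mult_less_eq mult.commute[of d] Suc_le_eq simp del: of_nat_mult)
    ultimately show "x \<in> (\<lambda>(a, b). (d * a, d * b)) ` unit_pairs p (M div d) v"
      by force
  next
    fix x assume "x \<in> (\<lambda>(a, b). (d * a, d * b)) ` unit_pairs p (M div d) v"
    then show "x \<in> {(a, b) \<in> unit_pairs p M v. d dvd a \<and> d dvd b}"
      using assms(1) unfolding unit_pairs_def
      by (auto simp: cong dvd less_eq_div_iff_mult_less_eq mult.commute[of d] Suc_le_eq simp del: of_nat_mult)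
  qed
  moreover have "inj_on (\<lambda>(a, b). (d * a, d * b)) (unit_pairs p (M div d) v)"
    using assms(1) by (auto simp: inj_on_def)
  ultimately show ?thesis
    using False by (simp add: card_image)
qed

text \<open>Moebius inversion: the indicator of coprimality is the sum of \<open>moebius\<close>
  over the common divisors, and the order of summation is exchanged.\<close>

lemma card_coprime_unit_pairs:
  assumes "prime p"
  shows "real (card {(a, b) \<in> unit_pairs p M v. coprime a b})
       = (\<Sum>d | d \<in> {1..M} \<and> \<not> p dvd d. moebius d * real (card (unit_pairs p (M div d) v)))"
proof -
  let ?U = "unit_pairs p M v"
  have div: "(if coprime a b then 1 else 0) = (\<Sum>d=1..M. if d dvd a \<and> d dvd b then moebius d else 0)"
    if "(a, b) \<in> ?U" for a b
  proof -
    have ab: "0 < a" "a \<le> M" using that by (auto simp: unit_pairs_def)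
    have "(\<Sum>d | d dvd gcd a b. moebius d) = (if gcd a b = 1 then 1 else 0)"
      using ab by (intro sum_moebius_divisors) simp
    then have "(if coprime a b then 1 else 0) = (\<Sum>d | d dvd gcd a b. moebius d)"
      unfolding coprime_iff_gcd_eq_1 by (rule sym)
    \<comment> \<open>A common divisor is at most a <= M, so one range of d serves all
      pairs.\<close>
    also have "{d. d dvd gcd a b} = {1..M} \<inter> {d. d dvd a \<and> d dvd b}"
    proof (intro equalityI subsetI)
      fix d assume "d \<in> {d. d dvd gcd a b}"
      then have "d dvd a" "d dvd b" by auto
      moreover from this have "0 < d" "d \<le> a" using ab dvd_imp_le dvd_pos_nat by blast+
      ultimately show "d \<in> {1..M} \<inter> {d. d dvd a \<and> d dvd b}" using ab by auto
    qed auto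
    finally show ?thesis by (simp add: sum.inter_restrict)
  qed
  have "real (card {(a, b) \<in> ?U. coprime a b}) = (\<Sum>(a, b)\<in>?U. if coprime a b then 1 else 0)"
    by (simp add: case_prod_unfold sum.If_cases Int_def)
  also have "\<dots> = (\<Sum>(a, b)\<in>?U. \<Sum>d=1..M. if d dvd a \<and> d dvd b then moebius d else 0)"
    by (intro sum.cong refl) (auto simp only: div split: prod.splits)
  also have "\<dots> = (\<Sum>d=1..M. \<Sum>(a, b)\<in>?U. if d dvd a \<and> d dvd b then moebius d else 0)"
    unfolding case_prod_unfold by (rule sum.swap)
  also have "\<dots> = (\<Sum>d=1..M. moebius d * real (card {(a, b) \<in> ?U. d dvd a \<and> d dvd b}))"
    by (simp add: case_prod_unfold sum.If_cases Int_def mult.commute)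
  also have "\<dots> = (\<Sum>d=1..M. if \<not> p dvd d then moebius d * real (card (unit_pairs p (M div d) v)) else 0)"
    using assms by (intro sum.cong refl) (simp add: card_unit_pairs_multiples)
  also have "\<dots> = (\<Sum>d | d \<in> {1..M} \<and> \<not> p dvd d. moebius d * real (card (unit_pairs p (M div d) v)))"
    by (subst sum.inter_filter[symmetric]) auto
  finally show ?thesis .
qed

section \<open>The main term after Moebius inversion\<close>

lemma sum_inverse_squares_le: "(\<Sum>m=1..M. 1 / (real m)\<^sup>2) \<le> 4"
proof (cases "M = 0")
  case False
  then have "(\<Sum>m=1..M. 1 / (real m)\<^sup>2) \<le> pi\<^sup>2 / 6 + 1 / real M"
    using basel_partial_sum[of M] by linarith
  moreover have "1 / real M \<le> 1" using False by simp
  \<comment> \<open>The crude bound pi < 4 suffices: 16/6 + 1 < 4.\<close>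
  moreover have "pi\<^sup>2 \<le> 4\<^sup>2" using pi_less_4 by (intro power_mono) auto
  ultimately show ?thesis by simp
qed simp

lemma sum_inverse_squares_multiples_le:
  assumes "p > 0"
  shows "(\<Sum>d | d \<in> {1..M} \<and> p dvd d. 1 / (real d)\<^sup>2) \<le> 4 / (real p)\<^sup>2"
proof -
  have "(\<Sum>d | d \<in> {1..M} \<and> p dvd d. 1 / (real d)\<^sup>2) = (\<Sum>k=1..M div p. 1 / (real (p * k))\<^sup>2)"
    using assms
    by (intro sum.reindex_bij_witness[of _ "\<lambda>k. p * k" "\<lambda>d. d div p"])
       (auto simp: less_eq_div_iff_mult_less_eq mult.commute Suc_le_eq elim!: dvdE)
  also have "\<dots> = (\<Sum>k=1..M div p. 1 / (real k)\<^sup>2) / (real p)\<^sup>2"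
    by (simp add: sum_divide_distrib power_mult_distrib mult.commute)
  also have "\<dots> \<le> 4 / (real p)\<^sup>2"
    by (intro divide_right_mono sum_inverse_squares_le) auto
  finally show ?thesis .
qed

text \<open>The terms with p dvd d are removed from the full sum; writing d = p k shows that they
  cost only 4 / p^2.\<close>

lemma moebius_coprime_squares_bound:
  assumes "p > 0" "M \<ge> 1"
  shows "\<bar>(\<Sum>d | d \<in> {1..M} \<and> \<not> p dvd d. moebius d / (real d)\<^sup>2) - 6 / pi\<^sup>2\<bar>
       \<le> 2 * (1 + ln (real M)) / real M + 4 / (real p)\<^sup>2"
proof -
  let ?f = "\<lambda>d. moebius d / (real d)\<^sup>2"
  have "(\<Sum>d=1..M. ?f d) = (\<Sum>d | d \<in> {1..M} \<and> \<not> p dvd d. ?f d) + (\<Sum>d | d \<in> {1..M} \<and> p dvd d. ?f d)"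
    by (subst sum.union_disjoint[symmetric]) (auto intro!: sum.cong)
  moreover have "\<bar>\<Sum>d | d \<in> {1..M} \<and> p dvd d. ?f d\<bar> \<le> (\<Sum>d | d \<in> {1..M} \<and> p dvd d. 1 / (real d)\<^sup>2)"
    using abs_moebius_le by (intro order_trans[OF sum_abs] sum_mono) (auto intro: divide_right_mono)
  ultimately show ?thesis
    using sum_inverse_squares_multiples_le[OF assms(1), of M] moebius_over_squares_bound[OF assms(2)]
    by linarith
qed

text \<open>Replacing (M div d)^2 by (T/d)^2 reduces the sum to T^2 times the one in
  \<open>moebius_coprime_squares_bound\<close>; the replacement errors add up to a harmonic
  sum.\<close>

lemma moebius_main_term:
  assumes "prime p" "T \<ge> 1" "M = nat \<lfloor>T\<rfloor>"
  shows "\<bar>(\<Sum>d | d \<in> {1..M} \<and> \<not> p dvd d. moebius d * (real (M div d))\<^sup>2) - 6 / pi\<^sup>2 * T\<^sup>2\<bar>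
       \<le> 6 * (T * (1 + ln T)) + 4 * (T\<^sup>2 / real p)"
proof -
  let ?D = "{d. d \<in> {1..M} \<and> \<not> p dvd d}"
  have p: "p > 0" using assms prime_gt_0_nat by blast
  have M: "M \<ge> 1" "real M \<le> T" "T < real M + 1"
    using assms(2,3) by (auto simp: le_nat_iff le_floor_iff)
  have lnM: "1 + ln (real M) \<le> 1 + ln T" "0 \<le> ln (real M)" using M by auto
  \<comment> \<open>M div d falls short of T/d by less than 1, so the difference of squares is at
    most 1 * 2T/d.\<close>
  have summand: "\<bar>moebius d * ((real (M div d))\<^sup>2 - (T / real d)\<^sup>2)\<bar> \<le> 2 * T * (1 / real d)" if "d \<in> {1..M}" for d
  proof -
    have d: "d > 0" using that by auto
    define x where "x = real (M div d)"
    have "M < (M div d + 1) * d"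
      using d by (metis Suc_eq_plus1 dividend_less_div_times add.commute mult_Suc)
    then have "real M + 1 \<le> real ((M div d + 1) * d)"
      by linarith
    then have "T < (x + 1) * real d" using M by (simp add: x_def algebra_simps)
    then have lower: "T / real d < x + 1" using d by (simp add: field_simps)
    have "x \<le> real M / real d" unfolding x_def by (rule of_nat_div_le_of_nat)
    also have "\<dots> \<le> T / real d" using M by (intro divide_right_mono) auto
    finally have upper: "x \<le> T / real d" .
    have "x \<ge> 0" by (simp add: x_def)
    have "\<bar>moebius d * (x\<^sup>2 - (T / real d)\<^sup>2)\<bar> \<le> 1 * \<bar>x\<^sup>2 - (T / real d)\<^sup>2\<bar>"
      unfolding abs_mult by (intro mult_right_mono abs_moebius_le) auto
    also have "\<dots> = (T / real d - x) * (T / real d + x)"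
    proof -
      have "x\<^sup>2 \<le> (T / real d)\<^sup>2"
        using upper \<open>x \<ge> 0\<close> by (rule power_mono)
      moreover have "(y - x) * (y + x) = y\<^sup>2 - x\<^sup>2" for y
        by (simp add: algebra_simps power2_eq_square)
      ultimately show ?thesis by simp
    qed
    also have "\<dots> \<le> 1 * (2 * (T / real d))"
      using upper lower \<open>x \<ge> 0\<close> by (intro mult_mono) auto
    finally show ?thesis by (simp add: x_def)
  qed
  have "\<bar>\<Sum>d\<in>?D. moebius d * ((real (M div d))\<^sup>2 - (T / real d)\<^sup>2)\<bar> \<le> (\<Sum>d\<in>?D. 2 * T * (1 / real d))"
    by (intro order_trans[OF sum_abs] sum_mono summand) auto
  also have "\<dots> \<le> (\<Sum>d=1..M. 2 * T * (1 / real d))"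
    using assms(2) by (intro sum_mono2) auto
  also have "\<dots> \<le> 2 * T * (1 + ln T)"
    unfolding sum_distrib_left[symmetric]
    using sum_inverse_le_ln[OF M(1)] lnM assms(2) by (intro mult_left_mono) auto
  finally have first: "\<bar>\<Sum>d\<in>?D. moebius d * ((real (M div d))\<^sup>2 - (T / real d)\<^sup>2)\<bar> \<le> 2 * (T * (1 + ln T))"
    by (simp only: mult.assoc)
  let ?S = "\<Sum>d\<in>?D. moebius d / (real d)\<^sup>2"
  have "T\<^sup>2 * \<bar>?S - 6 / pi\<^sup>2\<bar> \<le> T\<^sup>2 * (2 * (1 + ln (real M)) / real M + 4 / (real p)\<^sup>2)"
    using moebius_coprime_squares_bound[OF p M(1)] by (intro mult_left_mono) auto
  also have "\<dots> = T / real M * (2 * T * (1 + ln (real M))) + 4 * (T\<^sup>2 / (real p)\<^sup>2)"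
    by (simp add: power2_eq_square add_divide_distrib algebra_simps)
  \<comment> \<open>T < M + 1 <= 2 M bounds T/M by 2, and 1/p^2 is weakened to 1/p.\<close>
  also have "\<dots> \<le> 2 * (2 * T * (1 + ln T)) + 4 * (T\<^sup>2 / real p)"
  proof (intro add_mono mult_mono divide_left_mono)
    show "T / real M \<le> 2" using M by (simp add: field_simps)
    show "real p \<le> (real p)\<^sup>2" using p by (simp add: power2_eq_square)
  qed (use M lnM p assms in auto)
  finally have second: "\<bar>T\<^sup>2 * (?S - 6 / pi\<^sup>2)\<bar> \<le> 4 * (T * (1 + ln T)) + 4 * (T\<^sup>2 / real p)"
    by (simp add: abs_mult)
  have "(\<Sum>d\<in>?D. moebius d * (real (M div d))\<^sup>2) - 6 / pi\<^sup>2 * T\<^sup>2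
     = (\<Sum>d\<in>?D. moebius d * ((real (M div d))\<^sup>2 - (T / real d)\<^sup>2)) + T\<^sup>2 * (?S - 6 / pi\<^sup>2)"
    by (simp add: right_diff_distrib sum_subtractf sum_distrib_left power_divide mult_ac)
  also have "\<bar>\<dots>\<bar> \<le> 2 * (T * (1 + ln T)) + (4 * (T * (1 + ln T)) + 4 * (T\<^sup>2 / real p))"
    by (intro order_trans[OF abs_triangle_ineq] add_mono first second)
  finally show ?thesis by simp
qed

text \<open>For each v the deviation is at most the sum over d of the \<open>unit_pairs\<close>
  deviations plus the error of the main term. The latter carries a factor 1/p and is the same for
  all v, so the fewer than p values of v just cancel that factor.\<close>

lemma farey_count_deviation:
  assumes "prime p" "T \<ge> 1"
  shows "(\<Sum>v = 1..int p - 1. \<bar>real (farey_count T p v) - 6 / pi\<^sup>2 * (T\<^sup>2 / real p)\<bar>)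
       \<le> 10 * (T * sqrt (real p) * (1 + ln T) * (1 + ln (real p))\<^sup>2) + 8 * (T\<^sup>2 / real p)"
proof -
  define M where "M = nat \<lfloor>T\<rfloor>"
  let ?V = "{1..int p - 1}"
  let ?D = "{d. d \<in> {1..M} \<and> \<not> p dvd d}"
  let ?N = "\<lambda>d v. real (card (unit_pairs p (M div d) v))"
  let ?L = "(1 + ln (real p))\<^sup>2"
  let ?m = "(\<Sum>d\<in>?D. moebius d * (real (M div d))\<^sup>2) / real p"
  have "p \<ge> 2" using assms prime_ge_2_nat by blast
  then have p: "p \<ge> 2" "p > 0" "card ?V < p" by auto
  have M: "M \<ge> 1" "real M \<le> T"
    using assms(2) by (auto simp: le_nat_iff le_floor_iff M_def)
  have lnM: "1 + ln (real M) \<le> 1 + ln T" "0 \<le> ln (real M)" using M by auto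
  have ge1: "1 \<le> ?L" using p by (intro one_le_power) auto
  have main: "\<bar>?m - 6 / pi\<^sup>2 * (T\<^sup>2 / real p)\<bar> \<le> (6 * (T * (1 + ln T)) + 4 * (T\<^sup>2 / real p)) / real p"
  proof -
    have "?m - 6 / pi\<^sup>2 * (T\<^sup>2 / real p) = ((\<Sum>d\<in>?D. moebius d * (real (M div d))\<^sup>2) - 6 / pi\<^sup>2 * T\<^sup>2) / real p"
      by (simp add: diff_divide_distrib)
    then show ?thesis
      using divide_right_mono[OF moebius_main_term[OF assms M_def], of "real p"] by simp
  qed
  have point: "\<bar>real (farey_count T p v) - 6 / pi\<^sup>2 * (T\<^sup>2 / real p)\<bar>
      \<le> (\<Sum>d\<in>?D. \<bar>?N d v - (real (M div d))\<^sup>2 / real p\<bar>) + (6 * (T * (1 + ln T)) + 4 * (T\<^sup>2 / real p)) / real p" for v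
  proof -
    have eq: "real (farey_count T p v) - ?m = (\<Sum>d\<in>?D. moebius d * (?N d v - (real (M div d))\<^sup>2 / real p))"
      by (simp add: farey_count_eq[OF assms(1)] card_coprime_unit_pairs[OF assms(1)] flip: M_def)
         (simp add: right_diff_distrib sum_subtractf sum_divide_distrib)
    have "\<bar>real (farey_count T p v) - ?m\<bar> \<le> (\<Sum>d\<in>?D. \<bar>?N d v - (real (M div d))\<^sup>2 / real p\<bar>)"
      unfolding eq by (intro order_trans[OF sum_abs] sum_mono) (simp add: abs_mult mult_left_le_one_le abs_moebius_le)
    with main show ?thesis by linarith
  qed
  have "(\<Sum>v\<in>?V. \<bar>real (farey_count T p v) - 6 / pi\<^sup>2 * (T\<^sup>2 / real p)\<bar>)
      \<le> (\<Sum>v\<in>?V. (\<Sum>d\<in>?D. \<bar>?N d v - (real (M div d))\<^sup>2 / real p\<bar>) + (6 * (T * (1 + ln T)) + 4 * (T\<^sup>2 / real p)) / real p)"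
    by (intro sum_mono point)
  also have "\<dots> = (\<Sum>d\<in>?D. \<Sum>v\<in>?V. \<bar>?N d v - (real (M div d))\<^sup>2 / real p\<bar>)
      + real (card ?V) * ((6 * (T * (1 + ln T)) + 4 * (T\<^sup>2 / real p)) / real p)"
    unfolding sum.distrib sum_constant by (subst sum.swap) simp
  also have "\<dots> \<le> (\<Sum>d\<in>?D. 4 * real (M div d) * sqrt (real p) * ?L + (real (M div d))\<^sup>2 / real p)
      + real p * ((6 * (T * (1 + ln T)) + 4 * (T\<^sup>2 / real p)) / real p)"
    using p assms(2) by (intro add_mono sum_mono unit_pairs_deviation assms(1) mult_right_mono) auto
  also have "real p * ((6 * (T * (1 + ln T)) + 4 * (T\<^sup>2 / real p)) / real p) = 6 * (T * (1 + ln T)) + 4 * (T\<^sup>2 / real p)"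
    using p by simp
  finally have sum_le: "(\<Sum>v\<in>?V. \<bar>real (farey_count T p v) - 6 / pi\<^sup>2 * (T\<^sup>2 / real p)\<bar>)
    \<le> (\<Sum>d\<in>?D. 4 * real (M div d) * sqrt (real p) * ?L + (real (M div d))\<^sup>2 / real p)
      + (6 * (T * (1 + ln T)) + 4 * (T\<^sup>2 / real p))" .
  \<comment> \<open>By M div d <= T/d the linear terms sum to a harmonic sum, at most 1 + ln T, and
    the quadratic ones to a bounded sum.\<close>
  have "(\<Sum>d\<in>?D. 4 * real (M div d) * sqrt (real p) * ?L + (real (M div d))\<^sup>2 / real p)
      \<le> (\<Sum>d=1..M. 4 * T * sqrt (real p) * ?L * (1 / real d) + T\<^sup>2 / real p * (1 / (real d)\<^sup>2))"
  proof (rule order_trans[OF sum_mono sum_mono2])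
    fix d assume "d \<in> ?D"
    have "real (M div d) \<le> real M / real d" by (rule of_nat_div_le_of_nat)
    also have "\<dots> \<le> T / real d" using M by (intro divide_right_mono) auto
    finally have le: "real (M div d) \<le> T / real d" .
    then have "(real (M div d))\<^sup>2 \<le> (T / real d)\<^sup>2" by (intro power_mono) auto
    then have "(real (M div d))\<^sup>2 / real p \<le> (T / real d)\<^sup>2 / real p" by (intro divide_right_mono) auto
    moreover have "4 * real (M div d) * sqrt (real p) * ?L \<le> 4 * (T / real d) * sqrt (real p) * ?L"
      using le by (intro mult_right_mono) auto
    ultimately show "4 * real (M div d) * sqrt (real p) * ?L + (real (M div d))\<^sup>2 / real p
        \<le> 4 * T * sqrt (real p) * ?L * (1 / real d) + T\<^sup>2 / real p * (1 / (real d)\<^sup>2)"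
      by (simp add: power_divide mult_ac)
  qed (use assms(2) in auto)
  also have "\<dots> = 4 * T * sqrt (real p) * ?L * (\<Sum>d=1..M. 1 / real d) + (\<Sum>d=1..M. 1 / (real d)\<^sup>2) * (T\<^sup>2 / real p)"
    by (simp only: sum.distrib sum_distrib_left sum_distrib_right mult.commute[of "T\<^sup>2 / real p"])
  also have "\<dots> \<le> 4 * T * sqrt (real p) * ?L * (1 + ln T) + 4 * (T\<^sup>2 / real p)"
    using sum_inverse_le_ln[OF M(1)] lnM sum_inverse_squares_le[of M] assms(2)
    by (intro add_mono mult_left_mono mult_right_mono) auto
  finally have "(\<Sum>d\<in>?D. 4 * real (M div d) * sqrt (real p) * ?L + (real (M div d))\<^sup>2 / real p)
    \<le> 4 * T * sqrt (real p) * ?L * (1 + ln T) + 4 * (T\<^sup>2 / real p)" .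
  \<comment> \<open>The error 6 T (1 + ln T) is absorbed into the leading term, giving the constants
    4 + 6 = 10 and 4 + 4 = 8.\<close>
  moreover have "6 * (T * (1 + ln T)) * 1 \<le> 6 * (T * (1 + ln T)) * (sqrt (real p) * ?L)"
    using p ge1 assms(2) mult_mono[of 1 "sqrt (real p)" 1 ?L] by (intro mult_left_mono) auto
  ultimately show ?thesis
    using sum_le by (simp add: algebra_simps)
qed

text \<open>Below 1 there are no fractions at all. What remains is p - 1 copies of the expected
  value, at most T^2 in total since 6/pi^2 <= 1.\<close>

lemma farey_count_deviation_small:
  assumes "prime p" "0 < T" "T < 1"
  shows "(\<Sum>v = 1..int p - 1. \<bar>real (farey_count T p v) - 6 / pi\<^sup>2 * (T\<^sup>2 / real p)\<bar>) \<le> T"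
proof -
  have p: "p > 0" using assms prime_gt_0_nat by blast
  have "farey_count T p v = 0" for v
    using assms by (simp add: farey_count_eq unit_pairs_def floor_eq_iff)
  then have "(\<Sum>v = 1..int p - 1. \<bar>real (farey_count T p v) - 6 / pi\<^sup>2 * (T\<^sup>2 / real p)\<bar>)
      = real (p - 1) * (6 / pi\<^sup>2 * (T\<^sup>2 / real p))"
    using p by (simp add: of_nat_diff)
  also have "\<dots> \<le> real p * (1 * (T\<^sup>2 / real p))"
  proof (intro mult_mono)
    have "6 \<le> pi\<^sup>2" using power_mono[of 3 pi 2] pi_gt3 by simp
    then show "6 / pi\<^sup>2 \<le> 1" by simp
  qed auto
  also have "\<dots> = T * T" using p by (simp add: power2_eq_square)
  also have "\<dots> \<le> T" using assms by simp
  finally show ?thesis .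
qed

section \<open>Absorbing the logarithms\<close>

lemma ln_cube_le:
  fixes T :: real
  assumes "T \<ge> 1"
  shows "(1 + ln T) ^ 3 \<le> 1728 * T powr (1 / 4)"
proof -
  \<comment> \<open>From exp x >= 1 + x at x = ln T / 12. The 12 is chosen so that cubing gives the
    exponent 3/12 = 1/4; the constant is 12^3 = 1728.\<close>
  have "1 + ln T / 12 \<le> T powr (1 / 12)"
    using assms exp_ge_add_one_self[of "ln T / 12"] by (simp add: powr_def)
  then have "(1 + ln T) ^ 3 \<le> (12 * T powr (1 / 12)) ^ 3"
    using assms by (intro power_mono) auto
  also have "\<dots> = 1728 * T powr (1 / 4)"
    using assms by (simp add: power_mult_distrib powr_power)
  finally show ?thesis .
qed

text \<open>With p < T^(1/2), the factor p^(3/2) is at most T^(3/4) and the three logarithmic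
  factors at most 1728 T^(1/4), together 1728 T. Multiplication by T/p gives the claim.\<close>

lemma log_factor_le:
  assumes "p \<ge> 2" "(real p)\<^sup>2 < T"
  shows "T * sqrt (real p) * (1 + ln T) * (1 + ln (real p))\<^sup>2 \<le> 1728 * (T\<^sup>2 / real p)"
proof -
  have "1 \<le> (real p)\<^sup>2" using assms(1) by (intro one_le_power) auto
  then have T: "T > 1" using assms(2) by simp
  have pT: "real p \<le> T powr (1 / 2)"
    using assms(2) T by (simp add: powr_half_sqrt real_le_rsqrt)
  have "real p \<le> T"
    using assms self_le_power[of "real p" 2] by linarith
  then have "ln (real p) \<le> ln T"
    using assms T by (subst ln_le_cancel_iff) auto
  then have "(1 + ln T) * (1 + ln (real p))\<^sup>2 \<le> (1 + ln T) * (1 + ln T)\<^sup>2"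
    using T assms(1) by (intro mult_left_mono power_mono) auto
  also have "\<dots> = (1 + ln T) ^ 3" by (simp add: power2_eq_square power3_eq_cube)
  also have "\<dots> \<le> 1728 * T powr (1 / 4)" using T by (intro ln_cube_le) auto
  finally have logs: "(1 + ln T) * (1 + ln (real p))\<^sup>2 \<le> 1728 * T powr (1 / 4)" .
  have "sqrt (real p) * real p = real p powr (3 / 2)"
    using assms(1) powr_add[of "real p" "1 / 2" 1] by (simp add: powr_half_sqrt)
  also have "\<dots> \<le> (T powr (1 / 2)) powr (3 / 2)"
    using pT by (intro powr_mono2) auto
  also have "\<dots> = T powr (3 / 4)" by (simp add: powr_powr)
  finally have "(sqrt (real p) * real p) * ((1 + ln T) * (1 + ln (real p))\<^sup>2) \<le> T powr (3 / 4) * (1728 * T powr (1 / 4))"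
    using T assms(1) by (intro mult_mono[OF _ logs]) auto
  also have "\<dots> = 1728 * T"
    using T powr_add[of T "3 / 4" "1 / 4"] by simp
  finally have "T * ((sqrt (real p) * real p) * ((1 + ln T) * (1 + ln (real p))\<^sup>2)) \<le> T * (1728 * T)"
    using T by (intro mult_left_mono) auto
  then show ?thesis
    using assms(1) by (simp add: field_simps power2_eq_square)
qed

theorem theorem1:
  "\<exists>c > 0. \<exists>\<epsilon> :: real \<Rightarrow> nat \<Rightarrow> real.
     uniform_limit {p. prime p} \<epsilon> (\<lambda>_. 0) at_top \<and>
     (\<forall>(p :: nat) (T :: real). prime p \<longrightarrow> T > 0 \<longrightarrow>
        (\<Sum>v = 1..int p - 1. \<bar>real (farey_count T p v) - 6 / pi\<^sup>2 * (T\<^sup>2 / real p)\<bar>)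
          \<le> c * (T\<^sup>2 / real p + T * real p powr (1 / 2 + \<epsilon> T p)))"
proof -
  \<comment> \<open>For $T \le p^2$ all logarithms are at most $1 + 2 \ln p$, and $p^{g(p)} = (1 + 2 \ln p)^3$; moreover
    $p \ge T^{1/2}$, which makes the convergence uniform. For $T > p^2$ the logarithms are absorbed by $T^2/p$.\<close>
  define g :: "real \<Rightarrow> real" where "g x = 3 * ln (1 + 2 * ln x) / ln x" for x
  define \<epsilon> :: "real \<Rightarrow> nat \<Rightarrow> real" where "\<epsilon> T p = (if T \<le> (real p)\<^sup>2 then g (real p) else 0)" for T p
  have "uniform_limit {p. prime p} \<epsilon> (\<lambda>_. 0) at_top"
    unfolding uniform_limit_iff
  proof (intro allI impI)
    fix e :: real assume "e > 0"
    have "(g \<longlongrightarrow> 0) at_top"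
      unfolding g_def by real_asymp
    then obtain x0 where x0: "\<bar>g x\<bar> < e" if "x \<ge> x0" for x
      using \<open>e > 0\<close> by (auto simp: tendsto_iff eventually_at_top_linorder)
    \<comment> \<open>The threshold x0^2 works for all p at once: where the exponent is g(p), x0^2
      <= T <= p^2 forces p >= x0.\<close>
    show "\<forall>\<^sub>F T in at_top. \<forall>p\<in>{p. prime p}. dist (\<epsilon> T p) 0 < e"
      using eventually_ge_at_top[of "x0\<^sup>2"]
    proof eventually_elim
      case (elim T)
      show ?case
      proof (intro ballI)
        fix p :: nat
        show "dist (\<epsilon> T p) 0 < e"
        proof (cases "T \<le> (real p)\<^sup>2")
          case True
          then have "x0 \<le> real p"
            using elim by (intro power2_le_imp_le[of x0 "real p"]) auto
          then show ?thesis using x0 True by (simp add: \<epsilon>_def)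
        qed (use \<open>e > 0\<close> in \<open>simp add: \<epsilon>_def\<close>)
      qed
    qed
  qed
  \<comment> \<open>The largest constant arises for T > p^2, where 10 * 1728 + 8 = 17288 is needed;
    20000 is a round upper bound.\<close>
  moreover have "(\<Sum>v = 1..int p - 1. \<bar>real (farey_count T p v) - 6 / pi\<^sup>2 * (T\<^sup>2 / real p)\<bar>)
          \<le> 20000 * (T\<^sup>2 / real p + T * real p powr (1 / 2 + \<epsilon> T p))" (is "?lhs \<le> _")
    if "prime p" "T > 0" for p T
  proof -
    have p: "p \<ge> 2" using that prime_ge_2_nat by blast
    have lnp: "ln (real p) > 0" using p by simp
    define A B where "A = T\<^sup>2 / real p" and "B = T * real p powr (1 / 2 + \<epsilon> T p)"
    have nonneg: "A \<ge> 0" "B \<ge> 0"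
      using that by (auto simp: A_def B_def)
    consider "T < 1" | "1 \<le> T" "T \<le> (real p)\<^sup>2" | "1 \<le> T" "(real p)\<^sup>2 < T" by linarith
    then have "?lhs \<le> 20000 * A + 20000 * B"
    proof cases
      case 1
      \<comment> \<open>A nonnegative exponent makes the power of p at least 1, so the second error
        term alone dominates T.\<close>
      have "\<epsilon> T p \<ge> 0"
        using lnp by (auto simp: \<epsilon>_def g_def)
      then have "1 \<le> real p powr (1 / 2 + \<epsilon> T p)"
        using p by (intro ge_one_powr_ge_zero) auto
      then have "T \<le> B"
        using that by (simp add: B_def)
      then show ?thesis
        using farey_count_deviation_small[OF that 1] nonneg by linarith
    next
      case 2
      have pos: "exp (ln (1 + 2 * ln (real p))) = 1 + 2 * ln (real p)"
        using lnp by (intro exp_ln) linarith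
      have "real p powr g (real p) = (1 + 2 * ln (real p)) ^ 3"
        using lnp p pos by (simp add: powr_def g_def exp_of_nat_mult[of 3, simplified])
      then have pow: "real p powr (1 / 2 + \<epsilon> T p) = sqrt (real p) * (1 + 2 * ln (real p)) ^ 3"
        using 2 p by (simp add: \<epsilon>_def powr_add powr_half_sqrt)
      have "ln T \<le> ln ((real p)\<^sup>2)"
        using 2 p by (subst ln_le_cancel_iff) auto
      also have "\<dots> = 2 * ln (real p)"
        using p by (simp add: ln_realpow)
      finally have "(1 + ln T) * (1 + ln (real p))\<^sup>2 \<le> (1 + 2 * ln (real p)) * (1 + 2 * ln (real p))\<^sup>2"
        using lnp by (intro mult_mono power_mono) auto
      also have "\<dots> = (1 + 2 * ln (real p)) ^ 3" by (simp add: power2_eq_square power3_eq_cube)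
      finally have "T * sqrt (real p) * ((1 + ln T) * (1 + ln (real p))\<^sup>2) \<le> T * sqrt (real p) * (1 + 2 * ln (real p)) ^ 3"
        using that by (intro mult_left_mono) auto
      then have "T * sqrt (real p) * (1 + ln T) * (1 + ln (real p))\<^sup>2 \<le> B"
        by (simp add: B_def pow mult_ac)
      then show ?thesis
        using farey_count_deviation[OF that(1) 2(1)] nonneg
        unfolding A_def[symmetric] by linarith
    next
      case 3
      then show ?thesis
        using farey_count_deviation[OF that(1) 3(1)] log_factor_le[OF p 3(2)] nonneg
        unfolding A_def[symmetric] by linarith
    qed
    then show ?thesis by (simp add: A_def B_def)
  qed
  ultimately show ?thesis
    by (intro exI[of _ 20000] conjI exI[of _ \<epsilon>]) auto
qed

end
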